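(* There exists an uncountable ball space $(X,\mathcal{B})$ such that $(\mathcal{B},\subseteq)$ is a narrow poset, $\mathcal{B}$ is closed under finite intersections, $(X,\mathcal{B})$ is spherically complete, $(X,\mathcal{B})$ is not chain intersection stable, and there is no family $\mathcal{B}'\supseteq\mathcal{B}$ of nonempty subsets of $X$ such that $(X,\mathcal{B}')$ is both chain intersection closed and spherically complete.
   Context: A ball space $(X,\mathcal{B})$ is a nonempty set $X$ with a nonempty collection $\mathcal{B}$ of nonempty subsets of $X$. A chain in $\mathcal{B}$ is a nonempty subset linearly ordered by inclusion. $(X,\mathcal{B})$ is spherically complete if every chain has nonempty intersection; chain intersection closed if the intersection of every chain is either empty or in $\mathcal{B}$; chain intersection stable if for every nonempty family $\mathbb{F}$ of chains in $\mathcal{B}$ such that $\{\bigcap\mathcal{C}:\mathcal{C}\in\mathbb{F}\}$ is linearly ordered by inclusion, there is a chain $\mathcal{Y}\subseteq\mathcal{B}$ with $\bigcap\mathcal{Y}=\bigcap_{\mathcal{C}\in\mathbb{F}}\bigcap\mathcal{C}$. A poset is narrow if it contains no infinite set of pairwise incomparable elements. Uncountable refers to $\mathcal{B}$ (equivalently here, $X$). *)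

theory Defs
  imports Complex_Main "HOL-Library.Countable_Set"
begin

definition ball_space :: "'a set \<Rightarrow> 'a set set \<Rightarrow> bool" where
  "ball_space X \<B> \<longleftrightarrow> X \<noteq> {} \<and> \<B> \<noteq> {} \<and> (\<forall>B\<in>\<B>. B \<subseteq> X \<and> B \<noteq> {})"

definition ball_chain :: "'a set set \<Rightarrow> 'a set set \<Rightarrow> bool" where
  "ball_chain \<B> \<C> \<longleftrightarrow> \<C> \<noteq> {} \<and> \<C> \<subseteq> \<B> \<and> chain\<^sub>\<subseteq> \<C>"

text \<open>
  The following properties of a ball space \<open>(X, \<B>)\<close> depend on \<open>\<B>\<close> only: chains are
  nonempty, so no intersection below ever needs the ambient set \<open>X\<close>.
\<close>

definition spherically_complete :: "'a set set \<Rightarrow> bool" where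
  "spherically_complete \<B> \<longleftrightarrow> (\<forall>\<C>. ball_chain \<B> \<C> \<longrightarrow> \<Inter>\<C> \<noteq> {})"

definition chain_intersection_closed :: "'a set set \<Rightarrow> bool" where
  "chain_intersection_closed \<B> \<longleftrightarrow> (\<forall>\<C>. ball_chain \<B> \<C> \<longrightarrow> \<Inter>\<C> = {} \<or> \<Inter>\<C> \<in> \<B>)"

definition chain_intersection_stable :: "'a set set \<Rightarrow> bool" where
  "chain_intersection_stable \<B> \<longleftrightarrow>
     (\<forall>\<F>. \<F> \<noteq> {} \<longrightarrow> (\<forall>\<C>\<in>\<F>. ball_chain \<B> \<C>) \<longrightarrow> chain\<^sub>\<subseteq> {\<Inter>\<C> |\<C>. \<C> \<in> \<F>} \<longrightarrow>
        (\<exists>\<Y>. ball_chain \<B> \<Y> \<and> \<Inter>\<Y> = (\<Inter>\<C>\<in>\<F>. \<Inter>\<C>)))"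

text \<open>
  Intersections of nonempty finite families are balls outright (an empty intersection is not
  exempted), so in a ball space with this property any two balls meet.
\<close>

definition finite_intersection_closed :: "'a set set \<Rightarrow> bool" where
  "finite_intersection_closed \<B> \<longleftrightarrow>
     (\<forall>\<G>. \<G> \<noteq> {} \<longrightarrow> finite \<G> \<longrightarrow> \<G> \<subseteq> \<B> \<longrightarrow> \<Inter>\<G> \<in> \<B>)"

definition narrow :: "'a::order set \<Rightarrow> bool" where
  "narrow P \<longleftrightarrow>
     \<not> (\<exists>S\<subseteq>P. infinite S \<and> (\<forall>x\<in>S. \<forall>y\<in>S. x \<noteq> y \<longrightarrow> \<not> x \<le> y \<and> \<not> y \<le> x))"

end

theory Submission
  imports Defs "HOL-Analysis.Continuum_Not_Denumerable"
begin

text \<open>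
  Let \<open>W\<close> be a set of reals, disjoint from \<open>\<nat>\<close>, with a well-order of type \<open>\<omega>\<^sub>1\<close>, put
  \<open>X = W \<union> \<nat>\<close>, and let the balls be the unions of a nonempty final segment of \<open>W\<close> and a nonempty
  final segment of \<open>\<nat>\<close>. Ordered by reverse inclusion they form the product \<open>\<omega>\<^sub>1 \<times> \<omega>\<close>, which is
  narrow and in which joins are componentwise maxima. Since \<open>\<omega>\<^sub>1\<close> has uncountable cofinality, no
  chain can be unbounded in both components, so the space is spherically complete. But letting the
  first component run through \<open>\<omega>\<^sub>1\<close> shows that every final segment of \<open>\<nat>\<close> is the intersection of
  a chain of balls, and these final segments have empty intersection.
\<close>

section \<open>Well-orders of type \<omega>_1 inside uncountable sets\<close>

text \<open>Well-order \<open>V\<close>. If some element has uncountably many predecessors, cut off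
  strictly below the least such element; otherwise keep \<open>V\<close>. An uncountable well-order
  with countable initial segments has type \<omega>_1.\<close>

lemma uncountable_obtains_omega1_order:
  assumes "uncountable V"
  obtains W r where "W \<subseteq> V" "uncountable W" "well_order_on W r" "\<And>a. countable (under r a)"
proof -
  obtain s where s: "well_order_on V s"
    using well_order_on by blast
  have fld: "Field s = V"
    using s by (rule well_order_on_Field[symmetric])
  interpret s: wo_rel s
    using s fld by (simp add: wo_rel_def)
  show thesis
  proof (cases "\<exists>a\<in>V. uncountable (under s a)")
    case False
    have "countable (under s a)" for a
    proof (cases "a \<in> V")
      case True
      then show ?thesis using False by blast
    next
      case a: False
      then have "under s a = {}"
        using fld by (auto simp: under_def Field_def)
      then show ?thesis by simp
    qed
    then show thesis
      using that[of V s] assms s by blast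
  next
    case True
    define A where "A = {a\<in>V. uncountable (under s a)}"
    define a where "a = s.minim A"
    have A: "A \<subseteq> Field s" "A \<noteq> {}"
      using True fld by (auto simp: A_def)
    have aA: "a \<in> A"
      unfolding a_def using A by (rule s.minim_in)
    define W where "W = underS s a"
    have "under s a \<subseteq> insert a W"
      by (auto simp: W_def under_def underS_def)
    then have unc: "uncountable W"
      using aA by (auto simp: A_def dest: countable_subset)
    have WV: "W \<subseteq> V"
      using fld by (auto simp: W_def underS_def Field_def)
    have seg: "countable (under (Restr s W) b)" for b
    proof (cases "b \<in> W")
      case True
      then have b: "b \<in> V" "(b, a) \<in> s" "b \<noteq> a"
        using WV by (auto simp: W_def underS_def)
      have "b \<notin> A"
      proof
        assume "b \<in> A"
        then have "(a, b) \<in> s"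
          unfolding a_def using A(1) by (intro s.minim_least)
        then show False
          using b s.ANTISYM by (auto simp: antisym_def)
      qed
      then have "countable (under s b)"
        using b by (simp add: A_def)
      then show ?thesis
        by (rule countable_subset[rotated]) (auto simp: under_def)
    next
      case False
      then have "under (Restr s W) b = {}"
        by (auto simp: under_def)
      then show ?thesis by simp
    qed
    have "well_order_on W (Restr s W)"
      using s.WELL WV fld by (intro well_order_on_Restr) auto
    then show thesis
      using that[of W "Restr s W"] WV unc seg by blast
  qed
qed

text \<open>Disjointness from \<nat> lets the points of a ball determine both of its final segments.
  Outside \<open>W\<close> the set \<open>under r a\<close> is empty, so \<open>a\<close> may range
  over all reals.\<close>

locale omega1_plus_omega =
  fixes W :: "real set" and r :: "real rel"
  assumes well_order: "well_order_on W r"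
    and uncountable_W: "uncountable W"
    and countable_under: "countable (under r a)"
    and disjoint_Nats: "W \<inter> \<nat> = {}"
begin

lemma field: "Field r = W"
  using well_order by (rule well_order_on_Field[symmetric])

sublocale wo: wo_rel r
  using well_order field by (simp add: wo_rel_def)

lemma in_W: "(a, b) \<in> r \<Longrightarrow> a \<in> W" "(a, b) \<in> r \<Longrightarrow> b \<in> W"
  using field by (auto simp: Field_def)

lemma refl_W: "a \<in> W \<Longrightarrow> (a, a) \<in> r"
  using wo.REFL field by (auto simp: refl_on_def)

lemma trans_W: "(a, b) \<in> r \<Longrightarrow> (b, c) \<in> r \<Longrightarrow> (a, c) \<in> r"
  using wo.TRANS by (auto simp: trans_def)

lemma linear_W: "a \<in> W \<Longrightarrow> b \<in> W \<Longrightarrow> (a, b) \<in> r \<or> (b, a) \<in> r"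
  using wo.TOTALS field by auto

lemma of_nat_notin_W: "real n \<notin> W"
  using disjoint_Nats by auto

lemma W_nonempty: "W \<noteq> {}"
  using uncountable_W by auto

text \<open>Uncountable cofinality of \<omega>_1: countably many countable initial segments cannot
  cover \<open>W\<close>. Points of \<open>C\<close> outside \<open>W\<close> contribute only empty
  segments.\<close>

lemma countable_strictly_bounded:
  assumes "countable C"
  obtains b where "b \<in> W" "\<And>c. c \<in> C \<Longrightarrow> (b, c) \<notin> r"
proof -
  have "countable (\<Union>c\<in>C. under r c)"
    using assms countable_under by simp
  then have "\<not> W \<subseteq> (\<Union>c\<in>C. under r c)"
    using uncountable_W countable_subset by blast
  then show thesis
    using that by (auto simp: under_def)
qed

section \<open>Balls and the product order\<close>

definition tail_ball :: "real \<Rightarrow> nat \<Rightarrow> real set" where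
  "tail_ball a n = above r a \<union> real ` {n..}"

text \<open>These are the chains whose intersections lose all of \<open>W\<close> and so are no
  longer balls.\<close>

definition column :: "nat \<Rightarrow> real set set" where
  "column n = (\<lambda>a. tail_ball a n) ` W"

definition balls :: "real set set" where
  "balls = (\<Union>n. column n)"

lemma ballsE:
  assumes "B \<in> balls"
  obtains a n where "a \<in> W" "B = tail_ball a n"
  using assms by (auto simp: balls_def column_def)

lemma ballsI: "a \<in> W \<Longrightarrow> tail_ball a n \<in> balls"
  by (auto simp: balls_def column_def)

lemma of_nat_in_tail_ball_iff: "real k \<in> tail_ball a n \<longleftrightarrow> n \<le> k"
  using in_W(2) of_nat_notin_W by (auto simp: tail_ball_def above_def)

lemma W_in_tail_ball_iff: "b \<in> W \<Longrightarrow> b \<in> tail_ball a n \<longleftrightarrow> (a, b) \<in> r"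
  using of_nat_notin_W by (auto simp: tail_ball_def above_def)

lemma tail_ball_subset: "tail_ball a n \<subseteq> W \<union> \<nat>"
  using in_W(2) by (auto simp: tail_ball_def above_def)

text \<open>The least points of the two segments, \<open>a\<close> and \<open>real n\<close>, test
  the inclusion, which is thus the reversed product order on indices.\<close>

lemma tail_ball_subset_iff:
  assumes "a \<in> W"
  shows "tail_ball a n \<subseteq> tail_ball b m \<longleftrightarrow> (b, a) \<in> r \<and> m \<le> n"
proof
  assume sub: "tail_ball a n \<subseteq> tail_ball b m"
  have "a \<in> tail_ball a n" "real n \<in> tail_ball a n"
    using assms refl_W by (auto simp: W_in_tail_ball_iff of_nat_in_tail_ball_iff)
  then show "(b, a) \<in> r \<and> m \<le> n"
    using sub assms W_in_tail_ball_iff of_nat_in_tail_ball_iff by blast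
next
  assume "(b, a) \<in> r \<and> m \<le> n"
  then show "tail_ball a n \<subseteq> tail_ball b m"
    using trans_W by (auto simp: tail_ball_def above_def)
qed

lemma tail_ball_Int:
  assumes "(a, b) \<in> r"
  shows "tail_ball a n \<inter> tail_ball b m = tail_ball b (max n m)"
proof -
  have "x \<in> tail_ball a n \<inter> tail_ball b m \<longleftrightarrow> x \<in> tail_ball b (max n m)" if x: "x \<in> W \<union> \<nat>" for x
  proof (cases "x \<in> W")
    case True
    then show ?thesis
      using assms trans_W by (auto simp: W_in_tail_ball_iff)
  next
    case False
    with x obtain k where "x = real k"
      by (auto elim: Nats_cases)
    then show ?thesis
      by (auto simp: of_nat_in_tail_ball_iff)
  qed
  then show ?thesis
    using tail_ball_subset by blast
qed

section \<open>Columns and their intersections\<close>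

lemma chain_column: "ball_chain balls (column n)"
proof -
  have "chain\<^sub>\<subseteq> (column n)"
    using linear_W by (auto simp: chain_subset_def column_def tail_ball_subset_iff)
  then show ?thesis
    using W_nonempty by (auto simp: ball_chain_def balls_def column_def)
qed

lemma Inter_column: "\<Inter>(column n) = real ` {n..}"
proof
  show "\<Inter>(column n) \<subseteq> real ` {n..}"
  proof
    fix x assume x: "x \<in> \<Inter>(column n)"
    \<comment> \<open>For \<open>x\<close> in \<open>W\<close> this is an element strictly above
      \<open>x\<close>; for other \<open>x\<close> any element of \<open>W\<close>
      qualifies.\<close>
    obtain b where b: "b \<in> W" "(b, x) \<notin> r"
      using countable_strictly_bounded[of "{x}"] by auto
    then have "x \<in> tail_ball b n"
      using x by (auto simp: column_def)
    then show "x \<in> real ` {n..}"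
      using b by (auto simp: tail_ball_def above_def)
  qed
qed (auto simp: column_def tail_ball_def)

lemma Inter_tails_empty: "(\<Inter>n. real ` {n..}) = {}"
proof -
  have False if "x \<in> (\<Inter>n. real ` {n..})" for x
  proof -
    have "x \<in> real ` {0..}"
      using that by blast
    then obtain k where k: "x = real k"
      by blast
    have "x \<in> real ` {Suc k..}"
      using that by blast
    with k show False by auto
  qed
  then show ?thesis by blast
qed

lemma chain_tails: "chain\<^sub>\<subseteq> (range (\<lambda>n. real ` {n..}))"
proof -
  have "real ` {n..} \<subseteq> real ` {m..} \<or> real ` {m..} \<subseteq> real ` {n..}" for n m
    using nat_le_linear[of n m] by (auto intro!: imageI)
  then show ?thesis
    by (auto simp: chain_subset_def)
qed

section \<open>Properties of the ball space\<close>

lemma ball_space_balls: "ball_space (W \<union> \<nat>) balls"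
proof -
  have "B \<subseteq> W \<union> \<nat> \<and> B \<noteq> {}" if "B \<in> balls" for B
    using that tail_ball_subset by (elim ballsE) (auto simp: tail_ball_def)
  then show ?thesis
    using W_nonempty ballsI unfolding ball_space_def by blast
qed

lemma uncountable_balls: "uncountable balls"
proof
  assume "countable balls"
  then have "countable ((\<lambda>a. tail_ball a 0) ` W)"
    by (rule countable_subset[rotated]) (auto intro: ballsI)
  moreover have "inj_on (\<lambda>a. tail_ball a 0) W"
  proof (rule inj_onI)
    fix a b assume "a \<in> W" "b \<in> W" "tail_ball a 0 = tail_ball b 0"
    then have "(a, b) \<in> r" "(b, a) \<in> r"
      by (metis order_refl tail_ball_subset_iff)+
    then show "a = b"
      using wo.ANTISYM by (auto simp: antisym_def)
  qed
  ultimately show False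
    using uncountable_W countable_image_inj_on by blast
qed

text \<open>In an antichain \<open>S\<close> pick a ball with least first index \<open>a\<close> and
  some second index \<open>n\<close>. Every other member has second index below \<open>n\<close>,
  and each column, being a chain, contains at most one member, so \<open>S\<close> is
  finite.\<close>

lemma narrow_balls: "narrow balls"
  unfolding narrow_def
proof (intro notI, elim exE conjE)
  fix S
  assume S: "S \<subseteq> balls" "infinite S"
    and anti: "\<forall>x\<in>S. \<forall>y\<in>S. x \<noteq> y \<longrightarrow> \<not> x \<le> y \<and> \<not> y \<le> x"
  define A where "A = {a\<in>W. \<exists>n. tail_ball a n \<in> S}"
  obtain B where B: "B \<in> S" "B \<in> balls"
    using S by (metis finite.emptyI ex_in_conv subsetD)
  have A: "A \<subseteq> Field r" "A \<noteq> {}"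
    unfolding field using B by (auto simp: A_def elim!: ballsE)
  define a where "a = wo.minim A"
  have "a \<in> A"
    unfolding a_def using A by (rule wo.minim_in)
  then obtain n where n: "a \<in> W" "tail_ball a n \<in> S"
    by (auto simp: A_def)
  have "S \<subseteq> insert (tail_ball a n) (\<Union>m<n. S \<inter> column m)"
  proof
    fix B assume B: "B \<in> S"
    obtain b m where b: "b \<in> W" "B = tail_ball b m"
      using B S(1) by (meson ballsE subsetD)
    have "(a, b) \<in> r"
      unfolding a_def using A(1) B b by (intro wo.minim_least) (auto simp: A_def)
    then have "B \<subseteq> tail_ball a n" if "n \<le> m"
      using that b by (simp add: tail_ball_subset_iff)
    then have "B = tail_ball a n \<or> m < n"
      using anti B n by (meson linorder_not_le)
    then show "B \<in> insert (tail_ball a n) (\<Union>m<n. S \<inter> column m)"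
      using B b by (auto simp: column_def)
  qed
  moreover have "finite (S \<inter> column m)" for m
  proof -
    have "x = y" if "x \<in> S \<inter> column m" "y \<in> S \<inter> column m" for x y
      using that anti chain_column[of m] unfolding ball_chain_def chain_subset_def by (metis IntE)
    \<comment> \<open>If the left side is empty, the choice is arbitrary and the inclusion
      trivial.\<close>
    then have "S \<inter> column m \<subseteq> {SOME x. x \<in> S \<inter> column m}"
      using someI[of "\<lambda>x. x \<in> S \<inter> column m"] by blast
    then show ?thesis
      using finite_subset by blast
  qed
  ultimately have "finite S"
    by (meson finite_UN_I finite_insert finite_lessThan finite_subset)
  then show False
    using S(2) by blast
qed

lemma finite_intersection_closed_balls: "finite_intersection_closed balls"
proof -
  have Int: "B \<inter> C \<in> balls" if BC: "B \<in> balls" "C \<in> balls" for B C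
  proof -
    obtain a n b m where ab: "a \<in> W" "B = tail_ball a n" "b \<in> W" "C = tail_ball b m"
      using BC by (metis ballsE)
    from linear_W[OF ab(1,3)] show ?thesis
    proof
      assume "(a, b) \<in> r"
      then show ?thesis
        using ab by (simp add: tail_ball_Int ballsI)
    next
      assume "(b, a) \<in> r"
      then have "C \<inter> B \<in> balls"
        using ab by (simp add: tail_ball_Int ballsI)
      then show ?thesis
        by (simp add: Int_commute)
    qed
  qed
  have "\<Inter>\<G> \<in> balls" if "finite \<G>" "\<G> \<noteq> {}" "\<G> \<subseteq> balls" for \<G>
    using that by (induction \<G> rule: finite_ne_induct) (auto intro: Int)
  then show ?thesis
    by (simp add: finite_intersection_closed_def)
qed

text \<open>An empty intersection makes the second indices unbounded, as each natural number is
  missed by some ball. Countably many balls witness this, and their first indices have a strict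
  bound \<open>b\<close>; a ball missing \<open>b\<close> then cannot be comparable with all of
  them.\<close>

lemma spherically_complete_balls: "spherically_complete balls"
  unfolding spherically_complete_def
proof (intro allI impI notI)
  fix \<C> assume "ball_chain balls \<C>" and empty: "\<Inter>\<C> = {}"
  then have sub: "\<C> \<subseteq> balls" and chain: "chain\<^sub>\<subseteq> \<C>"
    by (auto simp: ball_chain_def)
  have "\<exists>a n. a \<in> W \<and> tail_ball a n \<in> \<C> \<and> k < n" for k
  proof -
    obtain B where B: "B \<in> \<C>" "real k \<notin> B"
      using empty by blast
    obtain a n where "a \<in> W" "B = tail_ball a n"
      using B(1) sub by (meson ballsE subsetD)
    then show ?thesis
      using B by (metis not_le of_nat_in_tail_ball_iff)
  qed
  then obtain f g where fg: "\<And>k. f k \<in> W" "\<And>k. tail_ball (f k) (g k) \<in> \<C>" "\<And>k. k < g k"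
    by metis
  obtain b where b: "b \<in> W" "\<And>k. (b, f k) \<notin> r"
    using countable_strictly_bounded[of "range f"] by (metis countableI_type countable_image rangeI)
  obtain B where B: "B \<in> \<C>" "b \<notin> B"
    using empty by blast
  obtain a n where a: "a \<in> W" "B = tail_ball a n"
    using B(1) sub by (meson ballsE subsetD)
  then have ba: "(b, a) \<in> r"
    using B(2) b(1) linear_W W_in_tail_ball_iff by blast
  \<comment> \<open>The witness for \<open>k = n\<close> has second index above that of
    \<open>B\<close>, while \<open>B\<close> has first index above \<open>f n\<close>; so neither
    inclusion is possible.\<close>
  have "B \<subseteq> tail_ball (f n) (g n) \<or> tail_ball (f n) (g n) \<subseteq> B"
    using chain B(1) fg(2) by (auto simp: chain_subset_def)
  then have "g n \<le> n \<or> (a, f n) \<in> r"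
    using a fg(1) by (auto simp: tail_ball_subset_iff)
  then show False
    using fg(3)[of n] ba b(2) trans_W by (meson leD)
qed

text \<open>The family of all columns refutes stability: its total intersection is empty, which
  spherical completeness forbids for a single chain of balls.\<close>

lemma not_chain_intersection_stable_balls: "\<not> chain_intersection_stable balls"
proof
  assume stable: "chain_intersection_stable balls"
  have "{\<Inter>\<C> |\<C>. \<C> \<in> range column} = (\<lambda>n. \<Inter>(column n)) ` UNIV"
    by blast
  also have "\<dots> = range (\<lambda>n. real ` {n..})"
    by (simp only: Inter_column)
  finally have "{\<Inter>\<C> |\<C>. \<C> \<in> range column} = range (\<lambda>n. real ` {n..})" .
  then have "chain\<^sub>\<subseteq> {\<Inter>\<C> |\<C>. \<C> \<in> range column}"
    using chain_tails by simp
  then obtain \<Y> where "ball_chain balls \<Y>" "\<Inter>\<Y> = (\<Inter>\<C>\<in>range column. \<Inter>\<C>)"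
    using stable[unfolded chain_intersection_stable_def, rule_format, of "range column"]
      chain_column by blast
  moreover have "(\<Inter>\<C>\<in>range column. \<Inter>\<C>) = {}"
    using Inter_column Inter_tails_empty by simp
  ultimately show False
    using spherically_complete_balls by (auto simp: spherically_complete_def)
qed

text \<open>Closure forces the nonempty column intersections into \<open>\<B>'\<close>, where they
  form a chain with empty intersection.\<close>

lemma no_spherically_complete_closed_extension:
  assumes "balls \<subseteq> \<B>'" "chain_intersection_closed \<B>'"
  shows "\<not> spherically_complete \<B>'"
proof
  assume complete: "spherically_complete \<B>'"
  have "real ` {n..} \<in> \<B>'" for n
  proof -
    have "ball_chain \<B>' (column n)"
      using chain_column[of n] assms(1) by (auto simp: ball_chain_def)
    then have "\<Inter>(column n) = {} \<or> \<Inter>(column n) \<in> \<B>'"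
      using assms(2) by (simp add: chain_intersection_closed_def)
    then show ?thesis
      by (auto simp: Inter_column)
  qed
  then have "ball_chain \<B>' (range (\<lambda>n. real ` {n..}))"
    using chain_tails by (auto simp: ball_chain_def)
  then show False
    using complete Inter_tails_empty by (auto simp: spherically_complete_def)
qed

end

theorem theorem4p5:
  shows "\<exists>(X :: real set) \<B>.
    ball_space X \<B> \<and> uncountable \<B> \<and> narrow \<B> \<and>
    finite_intersection_closed \<B> \<and>
    spherically_complete \<B> \<and>
    \<not> chain_intersection_stable \<B> \<and>
    \<not> (\<exists>\<B>'. \<B> \<subseteq> \<B>' \<and> ball_space X \<B>' \<and>
          chain_intersection_closed \<B>' \<and> spherically_complete \<B>')"
proof -
  \<comment> \<open>Removing \<nat> from the reals leaves an uncountable set in which to find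
    \<open>W\<close>.\<close>
  have "countable (\<nat> :: real set)"
    by (simp add: Nats_def)
  then have "uncountable (UNIV - \<nat> :: real set)"
    using uncountable_minus_countable[OF uncountable_UNIV_real] by blast
  then obtain W r where "W \<subseteq> UNIV - \<nat>" "uncountable W" "well_order_on W r"
    "\<And>a :: real. countable (under r a)"
    using uncountable_obtains_omega1_order by blast
  then interpret omega1_plus_omega W r
    by unfold_locales auto
  show ?thesis
    using ball_space_balls uncountable_balls narrow_balls finite_intersection_closed_balls
      spherically_complete_balls not_chain_intersection_stable_balls
      no_spherically_complete_closed_extension
    by blast
qed

end
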